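(* Let $U$ be an $(h,k)_q$-evasive subspace of $V=V(r,q^n)$. Then \[|U|\le\frac{(q^k-1)(q^{rn}-1)}{q^{hn}-1}+1.\]
   Context: $V(r,q^n)$ denotes an $r$-dimensional vector space over $\mathbb{F}_{q^n}$, viewed also as an $rn$-dimensional vector space over $\mathbb{F}_q$. For positive integers $h,k$, an $\mathbb{F}_q$-subspace $U$ of $V$ is $(h,k)_q$-evasive if $\langle U\rangle_{\mathbb{F}_{q^n}}$ has $\mathbb{F}_{q^n}$-dimension at least $h$ and every $h$-dimensional $\mathbb{F}_{q^n}$-subspace of $V$ meets $U$ in an $\mathbb{F}_q$-subspace of $\mathbb{F}_q$-dimension at most $k$. *)

theory Defs
  imports Complex_Main "HOL-Library.Cardinality"
begin

text \<open>
  The field with \<open>q\<close> elements and its extension with \<open>q ^ n\<close> elements are finite field types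
  \<open>'f\<close> and \<open>'e\<close>, linked by a field embedding \<open>\<iota> :: 'f \<Rightarrow> 'e\<close> (injectivity follows from
  \<open>\<iota> 1 = 1\<close>). The vector space \<open>V\<close> over \<open>'e\<close> is the whole type \<open>'v\<close>.
\<close>

definition field_embedding :: "('f::field \<Rightarrow> 'e::field) \<Rightarrow> bool" where
  "field_embedding \<iota> \<longleftrightarrow>
     (\<forall>x y. \<iota> (x + y) = \<iota> x + \<iota> y) \<and> (\<forall>x y. \<iota> (x * y) = \<iota> x * \<iota> y) \<and> \<iota> 1 = 1"

definition restrict_scalars ::
    "('f::field \<Rightarrow> 'e::field) \<Rightarrow> ('e \<Rightarrow> 'v::ab_group_add \<Rightarrow> 'v) \<Rightarrow> 'f \<Rightarrow> 'v \<Rightarrow> 'v" where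
  "restrict_scalars \<iota> scale = (\<lambda>c. scale (\<iota> c))"

lemma vector_space_restrict_scalars:
  assumes "field_embedding \<iota>" and "vector_space scale"
  shows "vector_space (restrict_scalars \<iota> scale)"
proof -
  interpret vector_space scale by fact
  show ?thesis
    using assms(1)
    by unfold_locales
      (simp_all add: field_embedding_def restrict_scalars_def scale_right_distrib scale_left_distrib)
qed

definition evasive ::
    "('f::field \<Rightarrow> 'e::field) \<Rightarrow> ('e \<Rightarrow> 'v::ab_group_add \<Rightarrow> 'v) \<Rightarrow> nat \<Rightarrow> nat \<Rightarrow> 'v set \<Rightarrow> bool" where
  "evasive \<iota> scale h k U \<longleftrightarrow>
     0 < h \<and> 0 < k \<and>
     module.subspace (restrict_scalars \<iota> scale) U \<and>
     h \<le> vector_space.dim scale (module.span scale U) \<and>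
     (\<forall>W. module.subspace scale W \<and> vector_space.dim scale W = h \<longrightarrow>
        vector_space.dim (restrict_scalars \<iota> scale) (U \<inter> W) \<le> k)"

end

theory Submission
  imports Defs
begin

text \<open>
  Double counting of the pairs \<open>(u, W)\<close> with \<open>W\<close> an \<open>h\<close>-dimensional subspace and \<open>u \<noteq> 0\<close> in
  \<open>U \<inter> W\<close>. By symmetry every nonzero vector lies in the same number \<open>d\<close> of the \<open>N\<close> subspaces of
  dimension \<open>h\<close>, so counting with \<open>V\<close> in place of \<open>U\<close> gives \<open>d (q\<^sup>r\<^sup>n - 1) = N (q\<^sup>h\<^sup>n - 1)\<close>, and
  evasiveness gives \<open>d (|U| - 1) \<le> N (q\<^sup>k - 1)\<close>.
\<close>

lemma CARD_field_ge_2: "2 \<le> CARD('a::{field, finite})"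
proof -
  have "card {0, 1 :: 'a} \<le> CARD('a)"
    by (rule card_mono) auto
  then show ?thesis by simp
qed

context vector_space
begin

text \<open>Adjoining \<open>b\<close> to \<open>B\<close> multiplies the size of the span by
  \<open>CARD('a)\<close>, since each of its vectors is uniquely \<open>scale c b + x\<close> with
  \<open>x\<close> in \<open>span B\<close>. The finiteness half later shows that the whole of
  \<open>'v\<close> is finite.\<close>

lemma card_span_independent:
  assumes "finite (UNIV :: 'a set)" and "finite B" and "independent B"
  shows "finite (span B) \<and> card (span B) = CARD('a) ^ card B"
  using assms(2,3)
proof (induction B rule: finite_induct)
  case empty
  then show ?case by simp
next
  case (insert b B)
  let ?f = "\<lambda>(c, x). scale c b + x"
  have B: "independent B" and b: "b \<notin> span B"
    using insert.prems insert.hyps by (auto simp: independent_insert)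
  have IH: "finite (span B)" "card (span B) = CARD('a) ^ card B"
    using insert.IH B by auto
  have img: "span (insert b B) = ?f ` (UNIV \<times> span B)"
  proof (intro equalityI subsetI)
    fix x assume "x \<in> span (insert b B)"
    then obtain c where "x - scale c b \<in> span B"
      using span_breakdown_eq by blast
    then show "x \<in> ?f ` (UNIV \<times> span B)"
      by (intro image_eqI[of _ _ "(c, x - scale c b)"]) auto
  next
    fix x assume "x \<in> ?f ` (UNIV \<times> span B)"
    then obtain c y where "x = scale c b + y" "y \<in> span B" by auto
    then show "x \<in> span (insert b B)"
      by (auto simp: span_breakdown_eq intro!: exI[of _ c])
  qed
  have inj: "inj_on ?f (UNIV \<times> span B)"
  proof (rule inj_onI, clarify)
    fix c x d y
    assume x: "x \<in> span B" and y: "y \<in> span B" and eq: "scale c b + x = scale d b + y"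
    have "scale (c - d) b = y - x"
      using eq by (simp add: scale_left_diff_distrib algebra_simps)
    then have *: "scale (c - d) b \<in> span B"
      using x y by (simp add: span_diff)
    \<comment> \<open>Otherwise dividing by \<open>c - d\<close> would put \<open>b\<close> into
      \<open>span B\<close>.\<close>
    have "c = d"
    proof (rule ccontr)
      assume "c \<noteq> d"
      then have "b = scale (inverse (c - d)) (scale (c - d) b)" by simp
      then show False using b span_scale[OF *, of "inverse (c - d)"] by simp
    qed
    then show "c = d \<and> x = y" using eq by simp
  qed
  show ?case
    unfolding img using inj IH assms(1) insert.hyps
    by (simp add: card_image card_cartesian_product)
qed

text \<open>Needed over both fields: the large one gives the sizes of \<open>W\<close> and of
  \<open>V\<close>, the small one that of \<open>U \<inter> W\<close>.\<close>

lemma card_subspace: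
  assumes "finite (UNIV :: 'a set)" and "finite S" and "subspace S"
  shows "card S = CARD('a) ^ dim S"
proof -
  obtain B where B: "B \<subseteq> S" "independent B" "S \<subseteq> span B" "card B = dim S"
    using basis_exists by blast
  have "span B = S"
    using B assms(3) by (simp add: span_minimal subset_antisym)
  then show ?thesis
    using card_span_independent[OF assms(1) finite_subset[OF B(1) assms(2)] B(2)] B(4) by simp
qed

text \<open>Extend \<open>{u, v}\<close> to a basis and exchange these two basis vectors. The
  resulting map is its own inverse, hence an automorphism.\<close>

lemma swap_independent_vectors:
  assumes "u \<noteq> v" and "independent {u, v}"
  obtains f where "Vector_Spaces.linear scale scale f" "\<And>x. f (f x) = x" "f u = v" "f v = u"
proof -
  interpret vs: vector_space_pair scale scale ..
  let ?B = "extend_basis {u, v}"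
  define p where "p = id (u := v, v := u)"
  define f where "f = vs.construct ?B p"
  have ind: "independent ?B" and sup: "{u, v} \<subseteq> ?B" and sp: "span ?B = UNIV"
    using extend_basis_superset independent_extend_basis span_extend_basis assms(2) by blast+
  have lin: "Vector_Spaces.linear scale scale f"
    unfolding f_def by (rule vs.linear_construct[OF ind])
  have f: "f b = p b" if "b \<in> ?B" for b
    unfolding f_def by (rule vs.construct_basis[OF ind that])
  have uv: "f u = v" "f v = u"
    using sup assms(1) by (auto simp: f p_def)
  have "f (f b) = id b" if "b \<in> ?B" for b
  proof (cases "b \<in> {u, v}")
    case True
    then show ?thesis using uv by auto
  next
    case False
    then have "f b = b" using f[OF that] by (simp add: p_def)
    then show ?thesis by simp
  qed
  then have "(f \<circ> f) x = id x" for x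
    using vs.linear_eq_on[of "f \<circ> f" id x ?B] lin sp Vector_Spaces.linear_compose[OF lin lin] linear_id
    by simp
  then show ?thesis using that lin uv by simp
qed

text \<open>A linear automorphism taking \<open>u\<close> to \<open>v\<close> maps the first family
  injectively into the second. The inequality suffices, as exchanging \<open>u\<close> and
  \<open>v\<close> gives the reverse one.\<close>

lemma card_subspaces_containing_le:
  assumes fin: "finite (UNIV :: 'b set)" and u: "u \<noteq> 0" and v: "v \<noteq> 0"
  shows "card {W. subspace W \<and> dim W = h \<and> u \<in> W} \<le> card {W. subspace W \<and> dim W = h \<and> v \<in> W}"
proof -
  have fin': "finite (A :: 'b set set)" for A
    by (rule finite_subset[OF _ finite_Pow_iff[THEN iffD2, OF fin]]) auto
  show ?thesis
  proof (cases "v \<in> span {u}")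
    \<comment> \<open>Proportional vectors cannot be swapped as part of a basis, but here every
      subspace through \<open>u\<close> already contains \<open>v\<close>.\<close>
    case True
    then have "v \<in> W" if "subspace W" "u \<in> W" for W
      using that span_minimal[of "{u}" W] by auto
    then show ?thesis by (intro card_mono fin') auto
  next
    case False
    then have "independent {v, u}"
      using u by (simp add: independent_insert dependent_single)
    moreover have "u \<noteq> v" using False by (auto intro: span_base)
    ultimately obtain f where f: "Vector_Spaces.linear scale scale f" "\<And>x. f (f x) = x" "f u = v"
      using swap_independent_vectors[of u v] by (auto simp: insert_commute)
    interpret vs: vector_space_pair scale scale ..
    have "inj f" by (metis injI f(2))
    have dim: "dim (f ` W) = dim W" for W
    proof -
      obtain B where B: "B \<subseteq> W" "independent B" "W \<subseteq> span B" "card B = dim W"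
        using basis_exists by blast
      have "independent (f ` B)"
        using vs.linear_independent_injective_image[OF f(1) B(2)] \<open>inj f\<close>
        by (auto intro: inj_on_subset)
      moreover have "f ` W \<subseteq> span (f ` B)"
        using B(3) vs.linear_span_image[OF f(1)] by auto
      moreover have "card (f ` B) = dim W"
        using \<open>inj f\<close> B(4) by (metis card_image inj_on_subset subset_UNIV)
      ultimately show ?thesis
        using B(1) by (metis basis_card_eq_dim image_mono)
    qed
    have "(`) f ` {W. subspace W \<and> dim W = h \<and> u \<in> W}
        \<subseteq> {W. subspace W \<and> dim W = h \<and> v \<in> W}"
      using dim f(3) vs.linear_subspace_image[OF f(1)] by auto
    moreover have "inj_on ((`) f) {W. subspace W \<and> dim W = h \<and> u \<in> W}"
      by (rule inj_onI) (simp only: inj_image_eq_iff[OF \<open>inj f\<close>])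
    ultimately show ?thesis
      by (intro card_inj_on_le[of "(`) f"] fin')
  qed
qed

text \<open>Span \<open>h\<close> vectors of a basis. This makes the family of subspaces in the
  double count nonempty, so that the common count \<open>d\<close> can be cancelled.\<close>

lemma exists_subspace_of_dim:
  assumes "finite S" and "h \<le> dim S"
  obtains W where "subspace W" "dim W = h"
proof -
  obtain B where B: "B \<subseteq> S" "independent B" "S \<subseteq> span B" "card B = dim S"
    using basis_exists by blast
  obtain C where C: "C \<subseteq> B" "card C = h"
    using obtain_subset_with_card_n[of h B] assms(2) B(4) by auto
  then have "dim (span C) = h"
    using dim_eq_card_independent[OF independent_mono[OF B(2) C(1)]] by simp
  then show ?thesis using that by blast
qed

end

theorem theorem4p3:
  fixes \<iota> :: "'f::{field, finite} \<Rightarrow> 'e::{field, finite}"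
    and scale :: "'e \<Rightarrow> 'v::ab_group_add \<Rightarrow> 'v"
    and Basis U :: "'v set"
    and q n r h k :: nat
  assumes "field_embedding \<iota>"
    and "CARD('f) = q" and "CARD('e) = q ^ n"
    and "finite_dimensional_vector_space scale Basis"
    and "vector_space.dim scale UNIV = r"
    and "evasive \<iota> scale h k U"
  shows "real (card U) \<le>
    (real q ^ k - 1) * (real q ^ (r * n) - 1) / (real q ^ (h * n) - 1) + 1"
proof -
  interpret V: finite_dimensional_vector_space scale Basis by fact
  interpret R: vector_space "restrict_scalars \<iota> scale"
    by (rule vector_space_restrict_scalars[OF assms(1) V.vector_space_axioms])
  have h: "0 < h" and U: "R.subspace U" and hU: "h \<le> V.dim (V.span U)"
    and ev: "\<And>W. V.subspace W \<Longrightarrow> V.dim W = h \<Longrightarrow> R.dim (U \<inter> W) \<le> k"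
    using assms(6) by (auto simp: evasive_def)
  have fin: "finite (S :: 'v set)" for S
    using V.card_span_independent[OF finite V.finite_Basis V.independent_Basis] V.span_Basis
    by (metis finite_subset subset_UNIV)
  have q: "2 \<le> q" using CARD_field_ge_2[where 'a = 'f] assms(2) by simp
  have n: "0 < n" using CARD_field_ge_2[where 'a = 'e] assms(3) by (cases n) auto
  define N where "N = {W. V.subspace W \<and> V.dim W = h}"
  have finN: "finite N"
    by (rule finite_subset[OF _ finite_Pow_iff[THEN iffD2, OF fin]]) auto
  \<comment> \<open>This is where the lower bound on the dimension of the span of \<open>U\<close>
    enters.\<close>
  obtain W0 where W0: "W0 \<in> N"
    using V.exists_subspace_of_dim[OF fin hU] by (auto simp: N_def)
  have cardW: "card W = q ^ (h * n)" if "W \<in> N" for W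
    using V.card_subspace[OF finite fin, of W] that assms(3)
    by (simp add: N_def power_mult[symmetric] mult.commute)
  have cardV: "CARD('v) = q ^ (r * n)"
    using V.card_subspace[OF finite fin V.subspace_UNIV] assms(3,5)
    by (simp add: power_mult[symmetric] mult.commute)
  have qh: "1 < q ^ (h * n)" using q h n by (simp add: one_less_power del: One_nat_def)
  then have "\<not> W0 \<subseteq> {0}"
    using cardW[OF W0] card_mono[of "{0}" W0] by auto
  then obtain w :: 'v where w: "w \<noteq> 0" by auto
  \<comment> \<open>The nonzero vector \<open>w\<close> is only a reference point; any other one
    gives the same count.\<close>
  define d where "d = card {W \<in> N. w \<in> W}"
  have d: "card {W \<in> N. u \<in> W} = d" if "u \<noteq> 0" for u
    using V.card_subspaces_containing_le[OF fin that w, of h]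
      V.card_subspaces_containing_le[OF fin w that, of h]
    by (simp add: d_def N_def conj_assoc)
  \<comment> \<open>Stated for any \<open>S\<close> through 0, to be used with \<open>V\<close> and
    with \<open>U\<close>. Each \<open>- 1\<close> removes the zero vector, so the truncated
    subtraction is exact.\<close>
  have count: "d * (card S - 1) = (\<Sum>W\<in>N. card (S \<inter> W) - 1)" if "0 \<in> S" for S :: "'v set"
  proof -
    have "d * (card S - 1) = (\<Sum>u\<in>S - {0}. card {W \<in> N. u \<in> W})"
      using that d by (simp add: fin card_Diff_singleton)
    also have "\<dots> = (\<Sum>W\<in>N. card {u \<in> S - {0}. u \<in> W})"
      by (rule sum_multicount_gen) (use fin finN in auto)
    also have "\<dots> = (\<Sum>W\<in>N. card (S \<inter> W) - 1)"
    proof (rule sum.cong[OF refl])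
      fix W assume "W \<in> N"
      then have "0 \<in> S \<inter> W" using that V.subspace_0 by (auto simp: N_def)
      moreover have "{u \<in> S - {0}. u \<in> W} = S \<inter> W - {0}" by auto
      ultimately show "card {u \<in> S - {0}. u \<in> W} = card (S \<inter> W) - 1"
        by (simp add: fin card_Diff_singleton)
    qed
    finally show ?thesis .
  qed
  have eqV: "d * (q ^ (r * n) - 1) = card N * (q ^ (h * n) - 1)"
    using count[of UNIV] cardV cardW by simp
  have "card (U \<inter> W) \<le> q ^ k" if "W \<in> N" for W
  proof -
    have W: "V.subspace W" "V.dim W = h" using that by (auto simp: N_def)
    \<comment> \<open>Over the small field \<open>U \<inter> W\<close> is a subspace too, so its
      size is a power of \<open>q\<close>, with exponent at most \<open>k\<close> by
      evasiveness.\<close>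
    have "R.subspace W"
      using W(1) by (intro R.subspaceI)
        (auto simp: restrict_scalars_def V.subspace_0 V.subspace_add V.subspace_scale)
    then have "card (U \<inter> W) = q ^ R.dim (U \<inter> W)"
      using R.card_subspace[OF finite fin R.subspace_inter[OF U]] assms(2) by simp
    then show ?thesis using ev[OF W] q by simp
  qed
  then have leU: "d * (card U - 1) \<le> card N * (q ^ k - 1)"
    using count[OF R.subspace_0[OF U]] sum_bounded_above[of N "\<lambda>W. card (U \<inter> W) - 1" "q ^ k - 1"]
    by (simp add: diff_le_mono)
  have N0: "0 < card N" using W0 finN card_gt_0_iff by blast
  \<comment> \<open>The right side of \<open>eqV\<close> is positive.\<close>
  have "d \<noteq> 0" using eqV N0 qh by (metis mult_is_0 less_not_refl zero_less_diff)
  have U0: "1 \<le> card U"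
    using R.subspace_0[OF U] fin[of U] by (metis One_nat_def Suc_leI card_gt_0_iff empty_iff)
  define a b c where "a = real q ^ (h * n) - 1" and "b = real q ^ (r * n) - 1"
    and "c = real q ^ k - 1"
  \<comment> \<open>With \<open>U0\<close>, this lets the subtractions on naturals pass to the
    reals.\<close>
  have pos: "1 \<le> q ^ m" for m using q by simp
  have eq: "real d * b = real (card N) * a"
    using arg_cong[OF eqV, of real] pos by (simp add: a_def b_def of_nat_diff)
  have le: "real d * (real (card U) - 1) \<le> real (card N) * c"
    using leU[folded of_nat_le_iff[where 'a = real]] pos U0 by (simp add: c_def of_nat_diff)
  have a: "0 < a"
    using qh[folded of_nat_less_iff[where 'a = real]] by (simp add: a_def)
  have "real d * ((real (card U) - 1) * a) \<le> real d * (c * b)"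
  proof -
    \<comment> \<open>Multiplying by \<open>a\<close> produces \<open>card N * a\<close>, which
      \<open>eq\<close> turns into \<open>d * b\<close>; this eliminates \<open>N\<close>, and
      \<open>d\<close> then cancels.\<close>
    have "real d * (real (card U) - 1) * a \<le> c * (real (card N) * a)"
      using mult_right_mono[OF le, of a] a by (simp add: mult_ac)
    then show ?thesis unfolding eq[symmetric] by (simp only: mult_ac)
  qed
  then have "(real (card U) - 1) * a \<le> c * b"
    using \<open>d \<noteq> 0\<close> by simp
  then have "real (card U) - 1 \<le> c * b / a"
    using a by (simp add: pos_le_divide_eq)
  then show ?thesis by (simp add: a_def b_def c_def)
qed

end
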